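(* Let $b$ be a holomorphic function on the unit ball $\mathbb{B}_n\subset\mathbb{C}^n$, and let $P$ be the Bergman projection on $\mathbb{B}_n$. The following statements are equivalent: (1) the commutator $[\bar b,P]$ is weak-type $(1,1)$; (2) $b\in H^\infty(\mathbb{B}_n)$, i.e. $b$ is bounded on $\mathbb{B}_n$.
   Context: $V$ is Lebesgue measure on $\mathbb{B}_n$ and $|E|=V(E)$. The Bergman projection is $Pf(z)=c_n\int_{\mathbb{B}_n}\frac{f(w)}{(1-\langle z,w\rangle)^{n+1}}\,dV(w)$, $c_n=n!/\pi^n$. The commutator is $[\bar b,P]f=\bar b\,Pf-P(\bar b f)$, where $\bar b$ is the complex conjugate of $b$. $[\bar b,P]$ is weak-type $(1,1)$ if there is $C>0$ such that $|\{z\in\mathbb{B}_n:|[\bar b,P]f(z)|>\lambda\}|\le \frac{C}{\lambda}\|f\|_{L^1(\mathbb{B}_n)}$ for all $\lambda>0$ and all bounded, compactly supported functions $f$ on $\mathbb{B}_n$ (a dense subspace of $L^1(\mathbb{B}_n)$ on which the commutator is defined for every holomorphic $b$). *)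

theory Defs
  imports "HOL-Analysis.Analysis"
begin

abbreviation unit_ball :: "(complex ^ 'n) set"
  where "unit_ball \<equiv> ball 0 1"

definition hermitian :: "complex ^ 'n \<Rightarrow> complex ^ 'n \<Rightarrow> complex"
  where "hermitian z w = (\<Sum>i\<in>UNIV. z $ i * cnj (w $ i))"

(* Holomorphy in several variables: real Frechet differentiability with a
   complex-linear derivative; meant for open S. *)
definition holomorphic_Cn_on :: "(complex ^ 'n \<Rightarrow> complex) \<Rightarrow> (complex ^ 'n) set \<Rightarrow> bool"
  where "holomorphic_Cn_on f S \<longleftrightarrow>
    (\<forall>z\<in>S. \<exists>D. (f has_derivative D) (at z) \<and> (\<forall>c v. D (c *s v) = c * D v))"

definition H_infinity :: "(complex ^ 'n \<Rightarrow> complex) set"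
  where "H_infinity = {f. holomorphic_Cn_on f unit_ball \<and> bounded (f ` unit_ball)}"

definition bergman_proj :: "(complex ^ 'n \<Rightarrow> complex) \<Rightarrow> complex ^ 'n \<Rightarrow> complex"
  where "bergman_proj f z =
    complex_of_real (fact CARD('n) / pi ^ CARD('n)) *
      (LINT w:unit_ball|lebesgue. f w / (1 - hermitian z w) ^ (CARD('n) + 1))"

definition commutator ::
  "(complex ^ 'n \<Rightarrow> complex) \<Rightarrow> ((complex ^ 'n \<Rightarrow> complex) \<Rightarrow> complex ^ 'n \<Rightarrow> complex)
    \<Rightarrow> (complex ^ 'n \<Rightarrow> complex) \<Rightarrow> complex ^ 'n \<Rightarrow> complex"
  where "commutator g T f = (\<lambda>z. g z * T f z - T (\<lambda>w. g w * f w) z)"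

(* Values outside the ball are irrelevant throughout, so the support condition
   only concerns points of the ball. *)
definition bounded_compactly_supported :: "(complex ^ 'n \<Rightarrow> complex) \<Rightarrow> bool"
  where "bounded_compactly_supported f \<longleftrightarrow>
    f \<in> borel_measurable (lebesgue_on unit_ball) \<and> bounded (f ` unit_ball) \<and>
    (\<exists>K. compact K \<and> K \<subseteq> unit_ball \<and> (\<forall>z\<in>unit_ball - K. f z = 0))"

(* The real-valued measure loses nothing here: superlevel sets inside the ball
   have finite measure, and for the commutator they are measurable because
   the functions it produces are continuous on the ball. *)
definition weak_type_1_1 ::
  "((complex ^ 'n \<Rightarrow> complex) \<Rightarrow> complex ^ 'n \<Rightarrow> complex) \<Rightarrow> bool"
  where "weak_type_1_1 T \<longleftrightarrow>
    (\<exists>C>0. \<forall>l>0. \<forall>f. bounded_compactly_supported f \<longrightarrow>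
      measure lebesgue {z\<in>unit_ball. cmod (T f z) > l} \<le> C / l * (LINT z:unit_ball|lebesgue. cmod (f z)))"

end

theory Submission
  imports Defs
begin

text \<open>
  If \<open>b\<close> is bounded, the commutator is dominated by the positive operator with kernel
  \<open>k z w = 1 / |1 - \<langle>z, w\<rangle>| ^ (n + 1)\<close>, so it suffices that this operator \<open>Q\<close> is of weak type (1,1).
  By duality this follows once every measurable \<open>G\<close> has a subset \<open>G'\<close> of at least
  two thirds of its measure with \<open>Q 1_G'\<close> uniformly bounded.  The kernel has the half estimate
  \<open>\<integral> k z w dw \<le> C\<close> over \<open>{w. |z| \<le> |w|}\<close>, and splitting a double integral according to which of
  \<open>|z|\<close>, \<open>|w|\<close> is larger shows that \<open>{Q 1_G > 4 C}\<close> has at most a third of the measure of \<open>G\<close>; let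
  \<open>G'\<close> be the rest of \<open>G\<close>.  Then \<open>Q 1_G'\<close> is bounded on \<open>G'\<close>, hence everywhere: since
  \<open>|1 - \<langle>z, w\<rangle>|\<close> is a quasi-metric, its value at \<open>z\<close> is controlled by the value at an almost nearest point
  of \<open>G'\<close>.

  Conversely, testing the commutator on the indicator of a small ball around \<open>w\<close> bounds the measure of
  \<open>{z. |b z - b w| |k z w| > l}\<close> by \<open>C / l\<close>. As \<open>k\<close> is bounded below on the whole ball, \<open>b w\<close>
  lies within a fixed distance of \<open>b z\<close> for more than half of all \<open>z\<close>, while \<open>b\<close> is bounded on a
  fixed set of more than half the volume.
\<close>

subsection \<open>Positive kernels on quasi-metric measure spaces\<close>

text \<open>\<open>d\<close> is positive even on the diagonal, so \<open>k\<close> is finite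
  everywhere; \<open>\<delta>\<close> plays the role of distance to the boundary. In the constant,
  \<open>4 * C\<close> bounds the potential \<open>\<psi> G'\<close> on \<open>G'\<close>,
  \<open>(3 * K) ^ N\<close> is the cost of leaving \<open>G'\<close>, and 3/2 the cost of returning
  from \<open>G'\<close> to \<open>G\<close>.\<close>

lemma weak_type_quasimetric_kernel:
  fixes M :: "'a measure" and d :: "'a \<Rightarrow> 'a \<Rightarrow> real" and \<delta> :: "'a \<Rightarrow> real"
    and f :: "'a \<Rightarrow> ennreal" and N :: nat and K C :: real
  defines "k \<equiv> \<lambda>x y. ennreal (1 / d x y ^ N)"
  assumes "finite_measure M"
    and d_meas [measurable]: "case_prod d \<in> borel_measurable (M \<Otimes>\<^sub>M M)"
    and \<delta>_meas [measurable]: "\<delta> \<in> borel_measurable M"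
    and f_meas [measurable]: "f \<in> borel_measurable M"
    and pos: "\<And>x y. x \<in> space M \<Longrightarrow> y \<in> space M \<Longrightarrow> 0 < d x y"
    and sym: "\<And>x y. x \<in> space M \<Longrightarrow> y \<in> space M \<Longrightarrow> d x y = d y x"
    and tri: "\<And>x y z. x \<in> space M \<Longrightarrow> y \<in> space M \<Longrightarrow> z \<in> space M \<Longrightarrow>
               d x y \<le> K * (d x z + d z y)"
    and C: "0 < C"
    and half: "\<And>x. x \<in> space M \<Longrightarrow>
               (\<integral>\<^sup>+ y. k x y * indicator {y. \<delta> y \<le> \<delta> x} y \<partial>M) \<le> ennreal C"
  shows "l * emeasure M {x \<in> space M. l < (\<integral>\<^sup>+ y. k x y * f y \<partial>M)}
         \<le> ennreal (6 * C * (3 * K) ^ N) * (\<integral>\<^sup>+ y. f y \<partial>M)"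
proof -
  interpret finite_measure M by fact
  interpret pair_sigma_finite M M ..
  have k_meas [measurable]: "case_prod k \<in> borel_measurable (M \<Otimes>\<^sub>M M)"
    unfolding k_def by (simp add: case_prod_beta')
  have k_meas_snd [measurable]: "k x \<in> borel_measurable M" if "x \<in> space M" for x
    using measurable_Pair2[OF k_meas that] by simp
  have k_sym: "k x y = k y x" if "x \<in> space M" "y \<in> space M" for x y
    using sym[OF that] by (simp add: k_def)
  define G where "G = {x \<in> space M. l < (\<integral>\<^sup>+ y. k x y * f y \<partial>M)}"
  define \<psi> where "\<psi> A x = (\<integral>\<^sup>+ y. k x y * indicator A y \<partial>M)" for A x
  have \<psi>_meas [measurable]: "\<psi> A \<in> borel_measurable M" if [measurable]: "A \<in> sets M" for A
    unfolding \<psi>_def by measurable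
  have G [measurable]: "G \<in> sets M" unfolding G_def by measurable
  define H where "H = {x \<in> space M. ennreal (4 * C) < \<psi> G x}"
  have H [measurable]: "H \<in> sets M" unfolding H_def by measurable
  \<comment> \<open>Chebyshev's inequality for \<open>\<psi> G\<close> on \<open>H\<close>; this
    leads to the double integral of \<open>k\<close> over \<open>H\<close> times
    \<open>G\<close>.\<close>
  have "ennreal (4 * C) * emeasure M H = (\<integral>\<^sup>+ x. ennreal (4 * C) * indicator H x \<partial>M)"
    by (simp add: nn_integral_cmult_indicator)
  also have "\<dots> \<le> (\<integral>\<^sup>+ x. \<psi> G x * indicator H x \<partial>M)"
    by (intro nn_integral_mono) (auto simp: H_def indicator_def)
  also have "\<dots> = (\<integral>\<^sup>+ x. \<integral>\<^sup>+ y. k x y * indicator G y * indicator H x \<partial>M \<partial>M)"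
    unfolding \<psi>_def by (intro nn_integral_cong nn_integral_multc[symmetric]) measurable
  \<comment> \<open>Either \<open>\<delta> y \<le> \<delta> x\<close>, and the constraint
    \<open>y \<in> G\<close> is dropped, or the reverse holds, and \<open>x \<in> H\<close> is
    dropped. After swapping the order of integration in the second term, \<open>half\<close> bounds
    both inner integrals.\<close>
  also have "\<dots> \<le> (\<integral>\<^sup>+ x. \<integral>\<^sup>+ y.
      (k x y * indicator {y. \<delta> y \<le> \<delta> x} y * indicator H x
      + k y x * indicator {x. \<delta> x \<le> \<delta> y} x * indicator G y) \<partial>M \<partial>M)"
    by (intro nn_integral_mono) (auto simp: indicator_def k_sym)
  also have "\<dots> = (\<integral>\<^sup>+ x. \<integral>\<^sup>+ y. k x y * indicator {y. \<delta> y \<le> \<delta> x} y * indicator H x \<partial>M \<partial>M)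
      + (\<integral>\<^sup>+ x. \<integral>\<^sup>+ y. k y x * indicator {x. \<delta> x \<le> \<delta> y} x * indicator G y \<partial>M \<partial>M)"
  proof -
    have [measurable]: "(\<lambda>(x, y). k x y * indicator {y. \<delta> y \<le> \<delta> x} y * indicator H x)
        \<in> borel_measurable (M \<Otimes>\<^sub>M M)"
      "(\<lambda>(x, y). k y x * indicator {x. \<delta> x \<le> \<delta> y} x * indicator G y)
        \<in> borel_measurable (M \<Otimes>\<^sub>M M)"
      unfolding indicator_def by measurable
    show ?thesis
      by (subst nn_integral_add[symmetric])
         (auto intro!: nn_integral_cong nn_integral_add)
  qed
  also have "(\<integral>\<^sup>+ x. \<integral>\<^sup>+ y. k y x * indicator {x. \<delta> x \<le> \<delta> y} x * indicator G y \<partial>M \<partial>M)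
     = (\<integral>\<^sup>+ y. \<integral>\<^sup>+ x. k y x * indicator {x. \<delta> x \<le> \<delta> y} x * indicator G y \<partial>M \<partial>M)"
    by (rule Fubini') (unfold indicator_def, measurable)
  also have "(\<integral>\<^sup>+ x. \<integral>\<^sup>+ y. k x y * indicator {y. \<delta> y \<le> \<delta> x} y * indicator H x \<partial>M \<partial>M) + \<dots>
     \<le> ennreal C * emeasure M H + ennreal C * emeasure M G"
  proof -
    have "(\<integral>\<^sup>+ x. \<integral>\<^sup>+ y. k x y * indicator {y. \<delta> y \<le> \<delta> x} y * indicator A x \<partial>M \<partial>M)
       \<le> ennreal C * emeasure M A" if [measurable]: "A \<in> sets M" for A
    proof -
      have "(\<integral>\<^sup>+ x. \<integral>\<^sup>+ y. k x y * indicator {y. \<delta> y \<le> \<delta> x} y * indicator A x \<partial>M \<partial>M)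
         \<le> (\<integral>\<^sup>+ x. ennreal C * indicator A x \<partial>M)"
        using half by (intro nn_integral_mono) (auto simp: indicator_def)
      then show ?thesis by (simp add: nn_integral_cmult_indicator)
    qed
    from add_mono[OF this[OF H] this[OF G]] show ?thesis .
  qed
  finally have HG: "ennreal (4 * C) * emeasure M H
      \<le> ennreal C * emeasure M H + ennreal C * emeasure M G" .
  \<comment> \<open>Finiteness of the measure lets \<open>C * measure M H\<close> be cancelled; out
    of the threshold \<open>4 * C\<close> a factor 3 survives.\<close>
  have HG': "3 * measure M H \<le> measure M G"
  proof -
    have "4 * C * measure M H \<le> C * measure M H + C * measure M G"
      using HG C unfolding emeasure_eq_measure
      by (simp add: ennreal_mult[symmetric] ennreal_plus[symmetric] del: ennreal_plus)
    then have "C * (3 * measure M H) \<le> C * measure M G" by (simp add: algebra_simps)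
    then show ?thesis using C by (simp only: mult_le_cancel_left_pos)
  qed
  define G' where "G' = G - H"
  have G' [measurable]: "G' \<in> sets M" unfolding G'_def by measurable
  have "measure M G \<le> measure M G' + measure M H"
    unfolding G'_def
    by (metis G H measure_Un_le finite_measure_mono sets.Diff sets.Un Un_Diff_cancel2 Un_upper1 order_trans)
  then have GG': "measure M G \<le> 3 / 2 * measure M G'" using HG' by simp
  \<comment> \<open>Shrinking \<open>G\<close> to \<open>G'\<close> only lowers the potential, and
    off \<open>H\<close> the potential of \<open>G\<close> is at most \<open>4 * C\<close>.\<close>
  have on_G': "\<psi> G' x \<le> ennreal (4 * C)" if "x \<in> G'" for x
  proof -
    have "\<psi> G' x \<le> \<psi> G x"
      unfolding \<psi>_def G'_def by (intro nn_integral_mono mult_left_mono) (auto simp: indicator_def)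
    also have "\<dots> \<le> ennreal (4 * C)"
      using that by (auto simp: G'_def G_def H_def not_less)
    finally show ?thesis .
  qed
  have G'_sub: "G' \<subseteq> space M" by (auto simp: G'_def G_def)
  (* A maximum principle: psi G' x is controlled by its value at an almost nearest point of G'. *)
  have everywhere: "\<psi> G' x \<le> ennreal ((3 * K) ^ N) * ennreal (4 * C)" if x: "x \<in> space M" for x
  proof (cases "G' = {}")
    case True
    then show ?thesis by (simp add: \<psi>_def)
  next
    case False
    define m where "m = Inf (d x ` G')"
    have bdd: "bdd_below (d x ` G')"
      using pos[OF x] G'_sub by (intro bdd_belowI[of _ 0]) (auto intro: less_imp_le)
    have "0 < d x x" using pos x by simp
    \<comment> \<open>The quasi-triangle inequality from \<open>x\<close> to itself via
      \<open>y\<close>. As \<open>d x x\<close> is positive, it yields both \<open>0 < K\<close> and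
      a positive infimum \<open>m\<close>, so some point of \<open>G'\<close> lies within
      \<open>2 * m\<close> of \<open>x\<close>.\<close>
    have "d x x \<le> 2 * K * d x y" if "y \<in> G'" for y
      using tri[OF x x, of y] sym[OF x, of y] that G'_sub by auto
    moreover from False obtain y0 where "y0 \<in> G'" by auto
    ultimately have K: "0 < K"
      by (smt (verit) G'_sub \<open>0 < d x x\<close> mult_nonneg_nonpos2 mult_nonpos_nonneg pos subset_iff x zero_less_mult_iff)
    have "d x x / (2 * K) \<le> m"
      unfolding m_def using False K \<open>\<And>y. y \<in> G' \<Longrightarrow> d x x \<le> 2 * K * d x y\<close>
      by (intro cINF_greatest) (auto simp: field_simps)
    then have "0 < m" using \<open>0 < d x x\<close> K
      by (smt (verit) divide_pos_pos)
    then have "Inf (d x ` G') < 2 * m" by (simp add: m_def)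
    then obtain y where y: "y \<in> G'" "d x y < 2 * m"
      using False bdd by (auto simp: cInf_less_iff)
    \<comment> \<open>For \<open>u\<close> in \<open>G'\<close> one has
      \<open>m \<le> d x u\<close>, hence
      \<open>d y u \<le> K * (2 * m + d x u) \<le> 3 * K * d x u\<close>.\<close>
    have "k x u * indicator G' u \<le> ennreal ((3 * K) ^ N) * (k y u * indicator G' u)" for u
    proof (cases "u \<in> G'")
      case True
      then have u: "u \<in> space M" and ysp: "y \<in> space M" using G'_sub y by auto
      have "m \<le> d x u" unfolding m_def using True bdd by (auto intro: cINF_lower)
      then have "d y u \<le> K * (2 * d x u + d x u)"
        using tri[OF ysp u x] sym[OF ysp x] y K
        by (smt (verit) mult_left_mono)
      then have "d y u \<le> 3 * K * d x u" by simp
      then have "d y u ^ N \<le> (3 * K) ^ N * d x u ^ N"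
        using pos[OF ysp u] by (metis less_imp_le power_mono power_mult_distrib)
      then have "1 / d x u ^ N \<le> (3 * K) ^ N * (1 / d y u ^ N)"
        using pos[OF ysp u] pos[OF x u] by (simp add: field_simps)
      then show ?thesis using True pos[OF ysp u] K
        by (simp add: k_def ennreal_mult[symmetric] ennreal_leI)
    qed simp
    then have "\<psi> G' x \<le> (\<integral>\<^sup>+ u. ennreal ((3 * K) ^ N) * (k y u * indicator G' u) \<partial>M)"
      unfolding \<psi>_def by (intro nn_integral_mono)
    also have "\<dots> = ennreal ((3 * K) ^ N) * \<psi> G' y"
      unfolding \<psi>_def using y G'_sub by (intro nn_integral_cmult) auto
    also have "\<dots> \<le> ennreal ((3 * K) ^ N) * ennreal (4 * C)"
      using on_G'[OF y(1)] by (rule mult_left_mono) simp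
    finally show ?thesis .
  qed
  \<comment> \<open>Duality: Tonelli and the symmetry of \<open>k\<close> move the operator from
    \<open>f\<close> to the indicator of \<open>G'\<close>, whose potential is uniformly
    bounded.\<close>
  have "l * emeasure M G' = (\<integral>\<^sup>+ x. l * indicator G' x \<partial>M)"
    by (simp add: nn_integral_cmult_indicator)
  also have "\<dots> \<le> (\<integral>\<^sup>+ x. (\<integral>\<^sup>+ y. k x y * f y \<partial>M) * indicator G' x \<partial>M)"
    by (intro nn_integral_mono) (auto simp: G'_def G_def indicator_def)
  also have "\<dots> = (\<integral>\<^sup>+ x. \<integral>\<^sup>+ y. k x y * f y * indicator G' x \<partial>M \<partial>M)"
    by (intro nn_integral_cong nn_integral_multc[symmetric]) measurable
  also have "\<dots> = (\<integral>\<^sup>+ y. \<integral>\<^sup>+ x. k x y * f y * indicator G' x \<partial>M \<partial>M)"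
    by (rule Fubini'[symmetric]) measurable
  also have "\<dots> = (\<integral>\<^sup>+ y. \<psi> G' y * f y \<partial>M)"
  proof (rule nn_integral_cong)
    fix y assume y: "y \<in> space M"
    have "(\<integral>\<^sup>+ x. k x y * f y * indicator G' x \<partial>M) = (\<integral>\<^sup>+ x. k y x * indicator G' x * f y \<partial>M)"
      using y by (intro nn_integral_cong) (auto simp: k_sym mult_ac)
    also have "\<dots> = \<psi> G' y * f y"
      unfolding \<psi>_def using y by (intro nn_integral_multc) measurable
    finally show "(\<integral>\<^sup>+ x. k x y * f y * indicator G' x \<partial>M) = \<psi> G' y * f y" .
  qed
  also have "\<dots> \<le> (\<integral>\<^sup>+ y. (ennreal ((3 * K) ^ N) * ennreal (4 * C)) * f y \<partial>M)"
    using everywhere by (intro nn_integral_mono mult_right_mono) auto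
  also have "\<dots> = (ennreal ((3 * K) ^ N) * ennreal (4 * C)) * (\<integral>\<^sup>+ y. f y \<partial>M)"
    by (intro nn_integral_cmult) measurable
  finally have main: "l * emeasure M G' \<le> \<dots>" .
  have "l * emeasure M G \<le> l * (ennreal (3 / 2) * emeasure M G')"
    using GG' unfolding emeasure_eq_measure
    by (intro mult_left_mono) (auto simp: ennreal_mult[symmetric] intro!: ennreal_leI)
  also have "\<dots> = ennreal (3 / 2) * (l * emeasure M G')" by (simp add: mult_ac)
  also have "\<dots> \<le> ennreal (3 / 2) * ((ennreal ((3 * K) ^ N) * ennreal (4 * C)) * (\<integral>\<^sup>+ y. f y \<partial>M))"
    using main by (rule mult_left_mono) simp
  also have "\<dots> = ennreal (3 / 2) * ennreal (4 * C) * ennreal ((3 * K) ^ N) * (\<integral>\<^sup>+ y. f y \<partial>M)"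
    by (simp add: mult_ac)
  also have "\<dots> = ennreal (6 * C * (3 * K) ^ N) * (\<integral>\<^sup>+ y. f y \<partial>M)"
    using C by (simp add: ennreal_mult'[symmetric])
  finally show ?thesis unfolding G_def .
qed

subsection \<open>Volume of spherical shells\<close>

(* Fubini for the translates X - t e: their average over t bounds the measure of X. *)
lemma emeasure_le_translates:
  fixes e :: "'a::euclidean_space"
  assumes [measurable]: "X \<in> sets borel" "Y \<in> sets borel"
    and R: "0 \<le> R" and m: "0 \<le> m"
    and sub: "\<And>v t. t \<in> {0..R} \<Longrightarrow> v + t *\<^sub>R e \<in> X \<Longrightarrow> v \<in> Y"
    and len: "\<And>v t t'. t \<in> {0..R} \<Longrightarrow> t' \<in> {0..R} \<Longrightarrow> v + t *\<^sub>R e \<in> X \<Longrightarrow> v + t' *\<^sub>R e \<in> X \<Longrightarrow> \<bar>t - t'\<bar> \<le> m"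
  shows "ennreal R * emeasure lborel X \<le> ennreal (2 * m) * emeasure lborel Y"
proof -
  let ?g = "\<lambda>t v. indicator X (v + t *\<^sub>R e) * indicator {0..R} t :: ennreal"
  have trans: "(\<integral>\<^sup>+ v. indicator X (v + a) \<partial>lborel) = emeasure lborel X" for a
  proof -
    have "emeasure lborel X = (\<integral>\<^sup>+ v. indicator X v \<partial>distr lborel borel ((+) a))"
      by (simp add: lborel_distr_plus)
    also have "\<dots> = (\<integral>\<^sup>+ v. indicator X (a + v) \<partial>lborel)"
      by (subst nn_integral_distr) auto
    finally show ?thesis by (simp add: add.commute)
  qed
  have "ennreal R * emeasure lborel X = (\<integral>\<^sup>+ t. emeasure lborel X * indicator {0..R} t \<partial>lborel)"
    using R by (simp add: nn_integral_cmult_indicator mult.commute)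
  also have "\<dots> = (\<integral>\<^sup>+ t. \<integral>\<^sup>+ v. ?g t v \<partial>lborel \<partial>lborel)"
    by (intro nn_integral_cong) (simp add: nn_integral_multc trans)
  also have "\<dots> = (\<integral>\<^sup>+ v. \<integral>\<^sup>+ t. ?g t v \<partial>lborel \<partial>lborel)"
    by (rule lborel_pair.Fubini') measurable
  also have "\<dots> \<le> (\<integral>\<^sup>+ v. ennreal (2 * m) * indicator Y v \<partial>lborel)"
  proof (rule nn_integral_mono)
    fix v :: 'a
    show "(\<integral>\<^sup>+ t. ?g t v \<partial>lborel) \<le> ennreal (2 * m) * indicator Y v"
    proof (cases "\<exists>t0\<in>{0..R}. v + t0 *\<^sub>R e \<in> X")
      case True
      then obtain t0 where t0: "t0 \<in> {0..R}" "v + t0 *\<^sub>R e \<in> X" by blast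
      \<comment> \<open>All admissible \<open>t\<close> lie within \<open>m\<close> of the one
        parameter \<open>t0\<close>; the interval centred there has length
        \<open>2 * m\<close>.\<close>
      have "(\<integral>\<^sup>+ t. ?g t v \<partial>lborel) \<le> (\<integral>\<^sup>+ t. indicator {t0 - m..t0 + m} t \<partial>lborel)"
        using len[OF t0(1) _ t0(2)]
        by (intro nn_integral_mono) (fastforce simp: indicator_def)
      also have "\<dots> = ennreal (2 * m)" using m by simp
      finally show ?thesis using sub[OF t0] by simp
    next
      case False
      then have "(\<integral>\<^sup>+ t. ?g t v \<partial>lborel) = (\<integral>\<^sup>+ t. 0 \<partial>(lborel :: real measure))"
        by (intro nn_integral_cong) (auto simp: indicator_def)
      then show ?thesis by simp
    qed
  qed
  also have "\<dots> = ennreal (2 * m) * emeasure lborel Y"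
    by (simp add: nn_integral_cmult_indicator)
  finally show ?thesis .
qed

text \<open>The set is thin in two orthogonal directions: its lines along \<open>p\<close> cross the
  shell in length of order \<open>\<epsilon>\<close>, its lines along \<open>q\<close> cross the
  slab in length of order \<open>R\<^sup>2\<close>. Spreading it by translations of length up to
  \<open>R\<close> in both directions stays inside a ball of radius \<open>4 * R\<close>, which
  gives the factors \<open>4 * \<epsilon> / R\<close> and \<open>8 * R\<^sup>2 / R\<close>.\<close>

lemma emeasure_shell_slab_le:
  fixes p q :: "'a::euclidean_space"
  assumes "norm p = 1" "norm q = 1" "p \<bullet> q = 0" and R: "0 < R" and \<epsilon>: "0 < \<epsilon>" "\<epsilon> \<le> 1"
  shows "emeasure lborel {u. 1 - \<epsilon> \<le> norm u \<and> norm u < 1 \<and> norm (u - p) < 2 * R \<and>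
            \<bar>u \<bullet> q\<bar> < 2 * R\<^sup>2 \<and> 1 / 2 \<le> u \<bullet> p}
         \<le> ennreal (32 * unit_ball_vol DIM('a) * 4 ^ DIM('a) * \<epsilon> * R ^ DIM('a))"
    (is "emeasure _ ?X \<le> _")
proof -
  define Y where "Y = {u. norm (u - p) < 3 * R \<and> \<bar>u \<bullet> q\<bar> < 2 * R\<^sup>2}"
  have pp: "p \<bullet> p = 1" and qq: "q \<bullet> q = 1"
    using assms by (simp_all add: norm_eq_1)
  have X_meas: "?X \<in> sets borel" by measurable
  have Y_meas: "Y \<in> sets borel" unfolding Y_def by measurable
  \<comment> \<open>Since \<open>w \<bullet> p\<close> is at least 1/2, a shift by \<open>h\<close>
    along \<open>p\<close> raises the squared norm by at least \<open>h\<close>, while squared norms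
    in the shell vary by at most \<open>2 * \<epsilon>\<close>.\<close>
  have gap: "t' - t \<le> 2 * \<epsilon>"
    if "v + t *\<^sub>R p \<in> ?X" "v + t' *\<^sub>R p \<in> ?X" "t \<le> t'" for v t t'
  proof -
    define w where "w = v + t *\<^sub>R p"
    define h where "h = t' - t"
    have w': "v + t' *\<^sub>R p = w + h *\<^sub>R p" by (simp add: w_def h_def algebra_simps)
    have "h \<ge> 0" using that by (simp add: h_def)
    have "(norm (w + h *\<^sub>R p))\<^sup>2 = (norm w)\<^sup>2 + 2 * h * (w \<bullet> p) + h\<^sup>2"
      unfolding power2_norm_eq_inner using pp
      by (simp add: inner_add_left inner_add_right inner_commute power2_eq_square)
    moreover have "(norm (w + h *\<^sub>R p))\<^sup>2 \<le> 1"
      using that(2) unfolding w' by (simp add: power_le_one)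
    moreover have "(norm w)\<^sup>2 \<ge> (1 - \<epsilon>)\<^sup>2"
      using that(1) \<epsilon> unfolding w_def[symmetric] by (intro power_mono) auto
    moreover have "2 * h * (w \<bullet> p) \<ge> 2 * h * (1 / 2)"
      using that(1) \<open>h \<ge> 0\<close> unfolding w_def[symmetric] by (intro mult_left_mono) auto
    moreover have "(1 - \<epsilon>)\<^sup>2 \<ge> 1 - 2 * \<epsilon>" by (simp add: power2_eq_square algebra_simps)
    moreover have "0 \<le> h\<^sup>2" by simp
    ultimately have "h \<le> 2 * \<epsilon>" by linarith
    then show ?thesis by (simp add: h_def)
  qed
  \<comment> \<open>Translation along \<open>p\<close> preserves the slab condition because
    \<open>p\<close> and \<open>q\<close> are orthogonal, and enlarges the radius from
    \<open>2 * R\<close> to \<open>3 * R\<close>.\<close>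
  have "ennreal R * emeasure lborel ?X \<le> ennreal (2 * (2 * \<epsilon>)) * emeasure lborel Y"
  proof (rule emeasure_le_translates[where e = p, OF X_meas Y_meas])
    fix v t t' assume *: "v + t *\<^sub>R p \<in> ?X" "v + t' *\<^sub>R p \<in> ?X"
    show "\<bar>t - t'\<bar> \<le> 2 * \<epsilon>"
      using gap[OF *] gap[OF *(2,1)] by (cases "t \<le> t'") auto
  next
    fix v t assume t: "t \<in> {0..R}" and *: "v + t *\<^sub>R p \<in> ?X"
    have "norm (v - p) \<le> norm (v + t *\<^sub>R p - p) + norm (t *\<^sub>R p)"
      using norm_triangle_ineq4[of "v + t *\<^sub>R p - p" "t *\<^sub>R p"] by simp
    then have "norm (v - p) < 3 * R" using * t assms(1) by auto
    then show "v \<in> Y" using * assms(3) by (simp add: Y_def inner_add_left)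
  qed (use R \<epsilon> in auto)
  moreover have "ennreal R * emeasure lborel Y \<le> ennreal (2 * (4 * R\<^sup>2)) * emeasure lborel (ball p (4 * R))"
  proof (rule emeasure_le_translates[where e = q, OF Y_meas])
    fix v t t' assume *: "v + t *\<^sub>R q \<in> Y" "v + t' *\<^sub>R q \<in> Y"
    then show "\<bar>t - t'\<bar> \<le> 4 * R\<^sup>2" using qq by (auto simp: Y_def inner_add_left)
  next
    fix v t assume t: "t \<in> {0..R}" and *: "v + t *\<^sub>R q \<in> Y"
    have "norm (v - p) \<le> norm (v + t *\<^sub>R q - p) + norm (t *\<^sub>R q)"
      using norm_triangle_ineq4[of "v + t *\<^sub>R q - p" "t *\<^sub>R q"] by (simp add: algebra_simps)
    then have "norm (v - p) < 4 * R" using * t assms(2) by (auto simp: Y_def)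
    then show "v \<in> ball p (4 * R)" by (simp add: dist_norm norm_minus_commute)
  qed (use R in auto)
  ultimately have "ennreal R * (ennreal R * emeasure lborel ?X)
      \<le> ennreal (4 * \<epsilon>) * (ennreal (8 * R\<^sup>2) * emeasure lborel (ball p (4 * R)))"
    by (smt (verit, ccfv_threshold) mult.assoc mult.left_commute mult_left_mono order_trans zero_le
        mult_numeral_left_semiring_numeral)
  also have "\<dots> = ennreal (R\<^sup>2) * ennreal (32 * \<epsilon> * (unit_ball_vol DIM('a) * (4 * R) ^ DIM('a)))"
    using R \<epsilon> by (subst emeasure_ball) (auto simp: ennreal_mult'[symmetric] mult_ac)
  finally have "ennreal (R\<^sup>2) * emeasure lborel ?X \<le> \<dots>"
    using R by (simp add: power2_eq_square ennreal_mult mult.assoc)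
  then have "emeasure lborel ?X \<le> ennreal (32 * \<epsilon> * (unit_ball_vol DIM('a) * (4 * R) ^ DIM('a)))"
    using R by (simp add: ennreal_mult_le_mult_iff)
  then show ?thesis by (simp add: power_mult_distrib mult_ac)
qed

text \<open>Bernoulli's inequality applied to the difference of the volumes of two concentric balls.
  This crude bound serves for quasi-metric balls of large radius.\<close>

lemma emeasure_shell_le:
  assumes \<epsilon>: "0 < \<epsilon>" "\<epsilon> \<le> 1"
  shows "emeasure lborel {u::'a::euclidean_space. 1 - \<epsilon> \<le> norm u \<and> norm u < 1}
    \<le> ennreal (unit_ball_vol DIM('a) * DIM('a) * \<epsilon>)"
proof -
  have "{u::'a. 1 - \<epsilon> \<le> norm u \<and> norm u < 1} = ball 0 1 - ball 0 (1 - \<epsilon>)" by auto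
  also have "emeasure lborel \<dots> = emeasure lborel (ball (0::'a) 1) - emeasure lborel (ball (0::'a) (1 - \<epsilon>))"
    using \<epsilon> emeasure_lborel_ball_finite by (intro emeasure_Diff) (auto simp: less_top[symmetric])
  also have "\<dots> = ennreal (unit_ball_vol DIM('a) * (1 - (1 - \<epsilon>) ^ DIM('a)))"
    using \<epsilon> by (simp add: emeasure_ball ennreal_minus algebra_simps)
  also have "\<dots> \<le> ennreal (unit_ball_vol DIM('a) * (DIM('a) * \<epsilon>))"
    using Bernoulli_inequality[of "- \<epsilon>" "DIM('a)"] \<epsilon>
    by (intro ennreal_leI mult_left_mono) auto
  finally show ?thesis by (simp add: mult.assoc)
qed

subsection \<open>The quasi-metric on the unit ball\<close>

lemma hermitian_diff_left: "hermitian (x - y) z = hermitian x z - hermitian y z"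
  and hermitian_diff_right: "hermitian z (x - y) = hermitian z x - hermitian z y"
  and hermitian_scaleR_right: "hermitian x (c *\<^sub>R y) = c *\<^sub>R hermitian x y"
  by (simp_all add: hermitian_def algebra_simps sum_subtractf scaleR_sum_right)

lemma cnj_hermitian: "cnj (hermitian x y) = hermitian y x"
  by (simp add: hermitian_def mult.commute)

lemma Re_hermitian: "Re (hermitian x y) = x \<bullet> y"
  by (simp add: hermitian_def inner_vec_def inner_complex_def)

text \<open>Turns a bound on the imaginary part of \<open>hermitian u p\<close> into a slab
  condition in the real direction \<open>\<i> *s p\<close>, which is orthogonal to
  \<open>p\<close>.\<close>

lemma Im_hermitian: "Im (hermitian x y) = x \<bullet> (\<i> *s y)"
  by (simp add: hermitian_def inner_vec_def inner_complex_def)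

lemma hermitian_self: "hermitian x x = of_real ((norm x)\<^sup>2)"
proof (rule complex_eqI)
  show "Im (hermitian x x) = Im (of_real ((norm x)\<^sup>2))"
    by (simp add: hermitian_def)
qed (simp add: Re_hermitian power2_norm_eq_inner)

lemma norm_hermitian_le: "cmod (hermitian x y) \<le> norm x * norm y"
proof -
  have "cmod (hermitian x y) \<le> (\<Sum>i\<in>UNIV. \<bar>cmod (x $ i)\<bar> * \<bar>cmod (y $ i)\<bar>)"
    unfolding hermitian_def by (rule order_trans[OF norm_sum]) (simp add: norm_mult)
  also have "\<dots> \<le> norm x * norm y" unfolding norm_vec_def by (rule L2_set_mult_ineq)
  finally show ?thesis .
qed

lemma continuous_on_hermitian [continuous_intros]:
  assumes "continuous_on S f" "continuous_on S g"
  shows "continuous_on S (\<lambda>x. hermitian (f x) (g x))"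
  unfolding hermitian_def by (intro continuous_intros assms)

lemma norm_imag_vec: "norm (\<i> *s (x :: complex ^ 'n)) = norm x"
  by (simp add: norm_vec_def norm_mult)

lemma koranyi_lower:
  assumes "norm w \<le> 1" shows "1 - norm z \<le> cmod (1 - hermitian z w)"
proof -
  have "1 - cmod (hermitian z w) \<le> cmod (1 - hermitian z w)"
    using norm_triangle_ineq2[of 1 "hermitian z w"] by simp
  moreover have "cmod (hermitian z w) \<le> norm z"
    using norm_hermitian_le[of z w] assms mult_left_mono[OF assms norm_ge_zero[of z]] by simp
  ultimately show ?thesis by simp
qed

text \<open>Letting one point reach the sphere allows a compact parameter domain when the kernel is
  later required to be uniformly continuous.\<close>

lemma koranyi_pos:
  assumes "norm z < 1" "norm w \<le> 1" shows "0 < cmod (1 - hermitian z w)"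
  using koranyi_lower[OF assms(2), of z] assms(1) by linarith

lemma koranyi_sym: "cmod (1 - hermitian z w) = cmod (1 - hermitian w z)"
  by (metis cnj_hermitian complex_cnj_diff complex_cnj_one complex_mod_cnj)

text \<open>Expand \<open>1 - hermitian a b\<close> as \<open>(1 - hermitian a c) + hermitian (a -
  c) (c - b) + (1 - hermitian c b)\<close> minus \<open>1 - (norm c)\<^sup>2\<close>. The cross term
  is controlled by Cauchy-Schwarz and
  \<open>(norm (x - y))\<^sup>2 \<le> 2 * cmod (1 - hermitian x y)\<close>, the last term by the
  distance of \<open>c\<close> to the sphere.\<close>

lemma koranyi_triangle:
  assumes "norm a \<le> 1" "norm b \<le> 1" "norm c \<le> 1"
  shows "cmod (1 - hermitian a b) \<le> 4 * (cmod (1 - hermitian a c) + cmod (1 - hermitian c b))"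
proof -
  have sq: "(norm (x - y))\<^sup>2 \<le> 2 * cmod (1 - hermitian x y)"
    if "norm x \<le> 1" "norm y \<le> 1" for x y :: "complex ^ 'n"
  proof -
    have "(norm (x - y))\<^sup>2 = (norm x)\<^sup>2 + (norm y)\<^sup>2 - 2 * Re (hermitian x y)"
      unfolding power2_norm_eq_inner Re_hermitian
      by (simp add: inner_diff_left inner_diff_right inner_commute)
    moreover have "(norm x)\<^sup>2 \<le> 1" "(norm y)\<^sup>2 \<le> 1" using that by (simp_all add: power_le_one)
    moreover have "Re (1 - hermitian x y) \<le> cmod (1 - hermitian x y)" by (rule complex_Re_le_cmod)
    ultimately show ?thesis by simp
  qed
  have "cmod (hermitian (a - c) (c - b)) \<le> norm (a - c) * norm (c - b)" by (rule norm_hermitian_le)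
  also have "\<dots> \<le> ((norm (a - c))\<^sup>2 + (norm (c - b))\<^sup>2) / 2"
    using sum_squares_bound[of "norm (a - c)" "norm (c - b)"] by simp
  also have "\<dots> \<le> cmod (1 - hermitian a c) + cmod (1 - hermitian c b)"
    using sq[of a c] sq[of c b] assms by simp
  finally have 1: "cmod (hermitian (a - c) (c - b)) \<le> \<dots>" .
  have "1 - (norm c)\<^sup>2 \<le> 2 * (1 - norm c)"
    using zero_le_power2[of "1 - norm c"] by (simp add: power2_eq_square algebra_simps)
  also have "\<dots> \<le> 2 * cmod (1 - hermitian c b)" using koranyi_lower[OF assms(2), of c] by simp
  finally have "1 - (norm c)\<^sup>2 \<le> \<dots>" .
  then have 2: "cmod (of_real (1 - (norm c)\<^sup>2)) \<le> 2 * cmod (1 - hermitian c b)"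
    using assms(3) unfolding norm_of_real by (simp add: power_le_one)
  have "1 - hermitian a b = (1 - hermitian a c) + hermitian (a - c) (c - b)
      + (1 - hermitian c b) - of_real (1 - (norm c)\<^sup>2)"
    by (simp add: hermitian_diff_left hermitian_diff_right hermitian_self)
  also have "cmod \<dots> \<le> cmod (1 - hermitian a c) + cmod (hermitian (a - c) (c - b))
      + cmod (1 - hermitian c b) + cmod (of_real (1 - (norm c)\<^sup>2))"
    by (intro norm_triangle_le norm_triangle_le_diff add_mono order_refl)
  finally have 3: "cmod (1 - hermitian a b) \<le> \<dots>" .
  \<comment> \<open>The four terms add up to \<open>2 * r + 4 * s\<close>.\<close>
  have "x \<le> 4 * (r + s)" if "x \<le> r + t + s + e" "t \<le> r + s" "e \<le> 2 * s" "0 \<le> r" for x r s t e :: real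
    using that by simp
  from this[OF 3 1 2 norm_ge_zero] show ?thesis .
qed

text \<open>For small \<open>r\<close> the set lies in a shell-slab of size \<open>sqrt r\<close>
  around \<open>z / norm z\<close>, with thickness of order \<open>r\<close> in the direction of
  \<open>\<i> *s z\<close>. For \<open>r\<close> at least 1/16 the factor
  \<open>16 ^ CARD('n) * r ^ CARD('n)\<close> is at least 1 and the volume of the whole shell
  suffices. The summands 32 and \<open>2 * CARD('n)\<close> come from these two cases.\<close>

lemma emeasure_koranyi_shell_le:
  fixes z :: "complex ^ 'n"
  assumes z: "norm z < 1" and \<epsilon>: "0 < \<epsilon>" "\<epsilon> \<le> 1" and r: "0 < r"
  shows "emeasure lborel {u. norm u < 1 \<and> 1 - \<epsilon> \<le> norm u \<and> cmod (1 - hermitian z u) < r}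
    \<le> ennreal (unit_ball_vol DIM(complex ^ 'n) * 16 ^ CARD('n) * (32 + 2 * CARD('n)) * \<epsilon> * r ^ CARD('n))"
    (is "emeasure _ ?A \<le> ennreal (?V * _ * _ * _ * _)")
proof (cases "r < 1 / 16 \<and> ?A \<noteq> {}")
  case True
  then obtain u0 where u0: "norm u0 < 1" "cmod (1 - hermitian z u0) < r" by auto
  \<comment> \<open>A single point of the set already forces \<open>z\<close> to be close to the
    sphere, so that normalising \<open>z\<close> is harmless.\<close>
  then have zr: "1 - norm z < r" using koranyi_lower[of u0 z] by simp
  define p where "p = (1 / norm z) *\<^sub>R z"
  have z0: "norm z > 0" using zr True by linarith
  have p: "norm p = 1" using z0 by (simp add: p_def)
  have q: "norm (\<i> *s p) = 1" using p by (simp add: norm_imag_vec)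
  have pq: "p \<bullet> (\<i> *s p) = 0" by (simp add: Im_hermitian[symmetric] hermitian_self)
  define R where "R = sqrt r"
  have R: "0 < R" "R\<^sup>2 = r" using r by (simp_all add: R_def)
  have sub: "u \<in> {u. 1 - \<epsilon> \<le> norm u \<and> norm u < 1 \<and> norm (u - p) < 2 * R \<and>
      \<bar>u \<bullet> (\<i> *s p)\<bar> < 2 * R\<^sup>2 \<and> 1 / 2 \<le> u \<bullet> p}" if "u \<in> ?A" for u
  proof -
    have u: "norm u < 1" "1 - \<epsilon> \<le> norm u" "cmod (1 - hermitian u z) < r"
      using that koranyi_sym[of u z] by auto
    \<comment> \<open>Replacing \<open>z\<close> by the unit vector \<open>p\<close> changes the
      form by at most \<open>1 - norm z\<close>, so the radius \<open>r\<close> becomes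
      \<open>2 * r\<close>.\<close>
    have "hermitian u z = norm z *\<^sub>R hermitian u p"
      using z0 by (simp add: p_def hermitian_scaleR_right)
    then have "1 - hermitian u p = (1 - hermitian u z) - (1 - norm z) *\<^sub>R hermitian u p"
      by (simp add: algebra_simps)
    also have "cmod \<dots> \<le> cmod (1 - hermitian u z) + (1 - norm z) * cmod (hermitian u p)"
      using z by (intro norm_triangle_le_diff) simp
    also have "\<dots> < r + r * 1"
      using u zr z norm_hermitian_le[of u p] p by (intro add_strict_mono mult_strict_mono) auto
    finally have a: "cmod (1 - hermitian u p) < 2 * r" by simp
    have Re: "1 - u \<bullet> p < 2 * r"
      using a complex_Re_le_cmod[of "1 - hermitian u p"] by (simp add: Re_hermitian)
    have Im: "\<bar>u \<bullet> (\<i> *s p)\<bar> < 2 * r"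
      using a abs_Im_le_cmod[of "1 - hermitian u p"] by (simp add: Im_hermitian)
    have "(norm (u - p))\<^sup>2 = (norm u)\<^sup>2 + 1 - 2 * (u \<bullet> p)"
      using p unfolding power2_norm_eq_inner norm_eq_1
      by (simp add: inner_diff_left inner_diff_right inner_commute)
    also have "(norm u)\<^sup>2 \<le> 1" using u by (simp add: power_le_one)
    finally have "(norm (u - p))\<^sup>2 < (2 * R)\<^sup>2" using Re R by (simp add: power_mult_distrib)
    then have up: "norm (u - p) < 2 * R" by (rule power2_less_imp_less) (use R(1) in linarith)
    have "r < 1 / 16" using True by blast
    with Re have "1 / 2 \<le> u \<bullet> p" by linarith
    with u up Im show ?thesis unfolding R(2) mem_Collect_eq by blast
  qed
  have "emeasure lborel ?A \<le> emeasure lborel {u. 1 - \<epsilon> \<le> norm u \<and> norm u < 1 \<and> norm (u - p) < 2 * R \<and>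
      \<bar>u \<bullet> (\<i> *s p)\<bar> < 2 * R\<^sup>2 \<and> 1 / 2 \<le> u \<bullet> p}"
    by (rule emeasure_mono[OF subsetI[OF sub]]) (assumption, measurable)
  also have "\<dots> \<le> ennreal (32 * ?V * 4 ^ DIM(complex ^ 'n) * \<epsilon> * R ^ DIM(complex ^ 'n))"
    by (rule emeasure_shell_slab_le[OF p q pq R(1) \<epsilon>])
  also have "\<dots> = ennreal (?V * 16 ^ CARD('n) * 32 * \<epsilon> * r ^ CARD('n))"
  proof -
    have "R ^ DIM(complex ^ 'n) = r ^ CARD('n)"
      by (simp add: mult.commute[of _ 2] power_mult R(2))
    moreover have "(4::real) ^ DIM(complex ^ 'n) = 16 ^ CARD('n)"
      by (simp add: mult.commute[of _ 2] power_mult)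
    ultimately show ?thesis by (simp only: mult_ac)
  qed
  also have "\<dots> \<le> ennreal (?V * 16 ^ CARD('n) * (32 + 2 * CARD('n)) * \<epsilon> * r ^ CARD('n))"
    using \<epsilon> r by (intro ennreal_leI mult_right_mono mult_left_mono) auto
  finally show ?thesis .
next
  case False
  show ?thesis
  proof (cases "?A = {}")
    case True
    then show ?thesis by (simp del: Collect_empty_eq)
  next
    case nonempty: False
    then have "1 \<le> 16 * r" using False by simp
    then have one: "1 \<le> 16 ^ CARD('n) * r ^ CARD('n)"
      by (metis one_le_power power_mult_distrib)
    have "emeasure lborel ?A \<le> emeasure lborel {u::complex ^ 'n. 1 - \<epsilon> \<le> norm u \<and> norm u < 1}"
      by (intro emeasure_mono) (auto, measurable)
    also have "\<dots> \<le> ennreal (?V * DIM(complex ^ 'n) * \<epsilon>)" by (rule emeasure_shell_le[OF \<epsilon>])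
    also have "\<dots> \<le> ennreal ((?V * (32 + 2 * CARD('n)) * \<epsilon>) * (16 ^ CARD('n) * r ^ CARD('n)))"
    proof (rule ennreal_leI)
      have "?V * DIM(complex ^ 'n) * \<epsilon> \<le> ?V * (32 + 2 * CARD('n)) * \<epsilon> * 1"
        using \<epsilon> by (auto intro!: mult_right_mono mult_left_mono)
      also have "\<dots> \<le> (?V * (32 + 2 * CARD('n)) * \<epsilon>) * (16 ^ CARD('n) * r ^ CARD('n))"
        using one \<epsilon> by (intro mult_left_mono) auto
      finally show "?V * DIM(complex ^ 'n) * \<epsilon> \<le> \<dots>" .
    qed
    finally show ?thesis by (simp only: mult_ac)
  qed
qed

section \<open>Dyadic bound for the kernel integral over the outer part of the ball\<close>

lemma ex_dyadic_interval:
  fixes x :: real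
  assumes "1 \<le> x" shows "\<exists>j. 2 ^ j \<le> x \<and> x < 2 ^ Suc j"
proof -
  define j where "j = (LEAST j. x < 2 ^ Suc j)"
  obtain n where "x < 2 ^ n" using real_arch_pow[of 2 x] by auto
  then have "x < 2 ^ Suc n" using assms by simp
  then have j: "x < 2 ^ Suc j" unfolding j_def by (rule LeastI)
  have "2 ^ j \<le> x"
  proof (cases j)
    case (Suc i)
    then have "\<not> x < 2 ^ Suc i" using not_less_Least[of i "\<lambda>j. x < 2 ^ Suc j"] by (simp add: j_def)
    then show ?thesis using Suc by simp
  qed (use assms in simp)
  with j show ?thesis by blast
qed

text \<open>Split according to the dyadic size of \<open>cmod (1 - hermitian z u)\<close> in units
  of \<open>\<epsilon> = 1 - norm z\<close>. Restricting to points at least as close to the sphere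
  as \<open>z\<close> gives a factor \<open>\<epsilon>\<close> in the volume of every piece, and
  this produces geometric decay.\<close>

lemma nn_integral_koranyi_kernel_le:
  "\<exists>C>0. \<forall>z::complex ^ 'n. norm z < 1 \<longrightarrow>
    (\<integral>\<^sup>+ u. ennreal (1 / cmod (1 - hermitian z u) ^ (CARD('n) + 1))
        * indicator {u. norm u < 1 \<and> 1 - norm u \<le> 1 - norm z} u \<partial>lborel) \<le> ennreal C"
proof -
  let ?n = "CARD('n)"
  define C0 where "C0 = unit_ball_vol DIM(complex ^ 'n) * 16 ^ ?n * (32 + 2 * ?n)"
  have C0: "C0 > 0" unfolding C0_def by (intro mult_pos_pos) auto
  have "(\<integral>\<^sup>+ u. ennreal (1 / cmod (1 - hermitian z u) ^ (?n + 1))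
        * indicator {u. norm u < 1 \<and> 1 - norm u \<le> 1 - norm z} u \<partial>lborel) \<le> ennreal (C0 * 2 ^ ?n * 2)"
    if z: "norm z < 1" for z :: "complex ^ 'n"
  proof -
    define \<epsilon> where "\<epsilon> = 1 - norm z"
    have \<epsilon>: "0 < \<epsilon>" "\<epsilon> \<le> 1" using z by (auto simp: \<epsilon>_def)
    \<comment> \<open>Only the upper distance bound enters, so the sets are nested rather than
      disjoint; this is enough for an upper bound.\<close>
    define A where "A j = {u. norm u < 1 \<and> 1 - \<epsilon> \<le> norm u \<and> cmod (1 - hermitian z u) < 2 ^ Suc j * \<epsilon>}" for j
    have [measurable]: "(\<lambda>u. hermitian z u) \<in> borel_measurable borel"
      by (intro borel_measurable_continuous_onI continuous_intros)
    have A_meas [measurable]: "A j \<in> sets borel" for j unfolding A_def by measurable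
    have "(\<integral>\<^sup>+ u. ennreal (1 / cmod (1 - hermitian z u) ^ (?n + 1))
        * indicator {u. norm u < 1 \<and> 1 - norm u \<le> 1 - norm z} u \<partial>lborel)
      \<le> (\<integral>\<^sup>+ u. (\<Sum>j. ennreal (1 / (2 ^ j * \<epsilon>) ^ (?n + 1)) * indicator (A j) u) \<partial>lborel)"
    proof (rule nn_integral_mono)
      fix u :: "complex ^ 'n"
      show "ennreal (1 / cmod (1 - hermitian z u) ^ (?n + 1))
          * indicator {u. norm u < 1 \<and> 1 - norm u \<le> 1 - norm z} u
        \<le> (\<Sum>j. ennreal (1 / (2 ^ j * \<epsilon>) ^ (?n + 1)) * indicator (A j) u)"
      proof (cases "norm u < 1 \<and> 1 - norm u \<le> 1 - norm z")
        case True
        \<comment> \<open>No distance is below \<open>\<epsilon>\<close>, so the dyadic scales start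
          at \<open>j = 0\<close>.\<close>
        then have "\<epsilon> \<le> cmod (1 - hermitian z u)" using koranyi_lower[of u z] by (simp add: \<epsilon>_def)
        then have "1 \<le> cmod (1 - hermitian z u) / \<epsilon>" using \<epsilon> by simp
        then obtain j where "2 ^ j \<le> cmod (1 - hermitian z u) / \<epsilon>" "cmod (1 - hermitian z u) / \<epsilon> < 2 ^ Suc j"
          using ex_dyadic_interval by blast
        then have j: "2 ^ j * \<epsilon> \<le> cmod (1 - hermitian z u)" "cmod (1 - hermitian z u) < 2 ^ Suc j * \<epsilon>"
          using \<epsilon> by (simp_all add: field_simps)
        have uA: "u \<in> A j" using True j by (simp add: A_def \<epsilon>_def)
        have "ennreal (1 / cmod (1 - hermitian z u) ^ (?n + 1))
          \<le> ennreal (1 / (2 ^ j * \<epsilon>) ^ (?n + 1)) * indicator (A j) u"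
        proof -
          have pos: "0 < 2 ^ j * \<epsilon>" using \<epsilon> by simp
          have "0 < cmod (1 - hermitian z u)" using pos j(1) by linarith
          then have "0 < cmod (1 - hermitian z u) ^ (?n + 1) * (2 ^ j * \<epsilon>) ^ (?n + 1)"
            using pos by (simp only: zero_less_power mult_pos_pos[OF zero_less_power zero_less_power])
          moreover have "(2 ^ j * \<epsilon>) ^ (?n + 1) \<le> cmod (1 - hermitian z u) ^ (?n + 1)"
            by (rule power_mono[OF j(1)]) (use pos in linarith)
          ultimately have "1 / cmod (1 - hermitian z u) ^ (?n + 1) \<le> 1 / (2 ^ j * \<epsilon>) ^ (?n + 1)"
            by (intro divide_left_mono) auto
          then show ?thesis using uA by (simp add: ennreal_leI del: power_Suc)
        qed
        also have "\<dots> \<le> (\<Sum>j. ennreal (1 / (2 ^ j * \<epsilon>) ^ (?n + 1)) * indicator (A j) u)"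
          using sum_le_suminf[of "\<lambda>j. ennreal (1 / (2 ^ j * \<epsilon>) ^ (?n + 1)) * indicator (A j) u" "{j}"]
          by (simp only: sum.insert finite.emptyI sum.empty empty_iff add_0_right not_False_eq_True finite.intros
               summableI zero_le simp_thms insert_iff)
        finally show ?thesis using True by simp
      qed simp
    qed
    also have "\<dots> = (\<Sum>j. ennreal (1 / (2 ^ j * \<epsilon>) ^ (?n + 1)) * emeasure lborel (A j))"
      by (subst nn_integral_suminf) (simp_all add: nn_integral_cmult_indicator)
    also have "\<dots> \<le> (\<Sum>j. ennreal (C0 * 2 ^ ?n * (1 / 2) ^ j))"
    proof (rule suminf_le)
      fix j
      have "ennreal (1 / (2 ^ j * \<epsilon>) ^ (?n + 1)) * emeasure lborel (A j)
         \<le> ennreal (1 / (2 ^ j * \<epsilon>) ^ (?n + 1)) * ennreal (C0 * \<epsilon> * (2 ^ Suc j * \<epsilon>) ^ ?n)"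
        unfolding A_def C0_def using \<epsilon>
        by (intro mult_left_mono emeasure_koranyi_shell_le[OF z]) auto
      also have "\<dots> = ennreal (1 / (2 ^ j * \<epsilon>) ^ (?n + 1) * (C0 * \<epsilon> * (2 * (2 ^ j * \<epsilon>)) ^ ?n))"
        using \<epsilon> C0 by (subst ennreal_mult[symmetric]) (auto simp: mult_ac)
      \<comment> \<open>The kernel has one power of \<open>2 ^ j * \<epsilon>\<close> more than the
        radius factor; the shell thickness cancels its \<open>\<epsilon>\<close> and leaves the
        decay in \<open>j\<close>.\<close>
      also have "1 / (2 ^ j * \<epsilon>) ^ (?n + 1) * (C0 * \<epsilon> * (2 * (2 ^ j * \<epsilon>)) ^ ?n) = C0 * 2 ^ ?n * (1 / 2) ^ j"
        unfolding power_mult_distrib[of 2] using \<epsilon> by (simp add: field_simps)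
      finally show "ennreal (1 / (2 ^ j * \<epsilon>) ^ (?n + 1)) * emeasure lborel (A j)
         \<le> ennreal (C0 * 2 ^ ?n * (1 / 2) ^ j)" .
    qed auto
    also have "\<dots> = ennreal (\<Sum>j. C0 * 2 ^ ?n * (1 / 2) ^ j)"
      using C0 by (intro suminf_ennreal2 summable_mult summable_geometric) auto
    also have "(\<Sum>j. C0 * 2 ^ ?n * (1 / 2) ^ j) = C0 * 2 ^ ?n * 2"
      by (subst suminf_mult) (simp_all add: summable_geometric suminf_geometric)
    finally show ?thesis .
  qed
  then show ?thesis using C0 by (intro exI[of _ "C0 * 2 ^ ?n * 2"]) auto
qed

subsection \<open>Weak type for bounded symbols\<close>

abbreviation ball_measure :: "(complex ^ 'n) measure"
  where "ball_measure \<equiv> lebesgue_on unit_ball"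

text \<open>Supplies the finite measure space of the abstract weak-type bound and makes bounded
  measurable functions on the ball integrable.\<close>

lemma finite_ball_measure: "finite_measure (ball_measure :: (complex ^ 'n) measure)"
  by (intro finite_measure_lebesgue_on) simp

lemma borel_measurable_hermitian_kernel [measurable]:
  "(\<lambda>(z, w). 1 - hermitian z w) \<in>
     borel_measurable (ball_measure \<Otimes>\<^sub>M (ball_measure :: (complex ^ 'n) measure))"
proof -
  have "(\<lambda>p. 1 - hermitian (fst p) (snd p)) \<in>
      borel_measurable (borel \<Otimes>\<^sub>M (borel :: (complex ^ 'n) measure))"
    unfolding borel_prod
    by (intro borel_measurable_continuous_onI continuous_intros)
  note meas = this
  have id: "(\<lambda>x. x) \<in> measurable ball_measure (borel :: (complex ^ 'n) measure)"
    by (intro measurable_restrict_space1 measurable_completion) simp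
  have "(\<lambda>p. (fst p, snd p)) \<in> measurable
      ((ball_measure :: (complex ^ 'n) measure) \<Otimes>\<^sub>M (ball_measure :: (complex ^ 'n) measure)) (borel \<Otimes>\<^sub>M borel)"
    by (rule measurable_Pair[OF measurable_compose[OF measurable_fst id] measurable_compose[OF measurable_snd id]])
  from measurable_compose[OF this meas] show ?thesis by (simp only: fst_conv snd_conv case_prod_beta')
qed

definition bergman_kernel :: "complex ^ 'n \<Rightarrow> complex ^ 'n \<Rightarrow> complex"
  where "bergman_kernel z w = complex_of_real (fact CARD('n) / pi ^ CARD('n)) / (1 - hermitian z w) ^ (CARD('n) + 1)"

lemma bergman_proj_eq:
  "bergman_proj f z = (\<integral>w. f w * bergman_kernel z w \<partial>ball_measure)"
  for f :: "complex ^ 'n \<Rightarrow> complex"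
proof -
  have "bergman_proj f z = complex_of_real (fact CARD('n) / pi ^ CARD('n)) *
      (\<integral>w. f w / (1 - hermitian z w) ^ (CARD('n) + 1) \<partial>ball_measure)"
    unfolding bergman_proj_def set_lebesgue_integral_def
    by (simp add: integral_restrict_space)
  also have "\<dots> = (\<integral>w. complex_of_real (fact CARD('n) / pi ^ CARD('n)) *
      (f w / (1 - hermitian z w) ^ (CARD('n) + 1)) \<partial>ball_measure)"
    \<comment> \<open>For a non-integrable integrand both sides are 0.\<close>
    by (rule integral_mult_right_zero[symmetric])
  finally show ?thesis by (simp add: bergman_kernel_def mult_ac)
qed

lemma borel_measurable_bergman_kernel [measurable]:
  "(\<lambda>(z, w). bergman_kernel z w) \<in> borel_measurable (ball_measure \<Otimes>\<^sub>M (ball_measure :: (complex ^ 'n) measure))"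
proof -
  note [measurable] = borel_measurable_hermitian_kernel[unfolded case_prod_beta']
  show ?thesis unfolding bergman_kernel_def case_prod_beta' by measurable
qed

lemma borel_measurable_bergman_proj:
  assumes [measurable]: "f \<in> borel_measurable (ball_measure :: (complex ^ 'n) measure)"
  shows "bergman_proj f \<in> borel_measurable (ball_measure :: (complex ^ 'n) measure)"
proof -
  interpret finite_measure "ball_measure :: (complex ^ 'n) measure" by (rule finite_ball_measure)
  note [measurable] = borel_measurable_bergman_kernel[unfolded case_prod_beta']
  show ?thesis unfolding bergman_proj_eq[abs_def]
    by (rule borel_measurable_lebesgue_integral) (unfold case_prod_beta', measurable)
qed

text \<open>A non-integrable function has Bochner integral 0, so the bound is trivial in that
  case.\<close>

lemma norm_integral_le_nn_integral:
  fixes f :: "'a \<Rightarrow> 'b::{banach, second_countable_topology}"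
  shows "ennreal (norm (integral\<^sup>L M f)) \<le> (\<integral>\<^sup>+ x. ennreal (norm (f x)) \<partial>M)"
  by (cases "integrable M f") (simp_all add: integral_norm_bound_ennreal not_integrable_integral_eq)

section \<open>Weak type of the positive operator and of commutators with bounded symbols\<close>

lemma nn_integral_half_koranyi_kernel_le:
  "\<exists>C>0. \<forall>z\<in>space (ball_measure :: (complex ^ 'n) measure).
    (\<integral>\<^sup>+ u. ennreal (1 / cmod (1 - hermitian z u) ^ (CARD('n) + 1))
        * indicator {u. 1 - norm u \<le> 1 - norm z} u \<partial>ball_measure) \<le> ennreal C"
proof -
  obtain C where C: "C > 0" "\<And>z::complex ^ 'n. norm z < 1 \<Longrightarrow>
    (\<integral>\<^sup>+ u. ennreal (1 / cmod (1 - hermitian z u) ^ (CARD('n) + 1))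
        * indicator {u. norm u < 1 \<and> 1 - norm u \<le> 1 - norm z} u \<partial>lborel) \<le> ennreal C"
    using nn_integral_koranyi_kernel_le by blast
  have "(\<integral>\<^sup>+ u. ennreal (1 / cmod (1 - hermitian z u) ^ (CARD('n) + 1))
        * indicator {u. 1 - norm u \<le> 1 - norm z} u \<partial>ball_measure) \<le> ennreal C"
    if "z \<in> space ball_measure" for z :: "complex ^ 'n"
  proof -
    have "(\<integral>\<^sup>+ u. ennreal (1 / cmod (1 - hermitian z u) ^ (CARD('n) + 1))
        * indicator {u. 1 - norm u \<le> 1 - norm z} u \<partial>ball_measure)
      = (\<integral>\<^sup>+ u. ennreal (1 / cmod (1 - hermitian z u) ^ (CARD('n) + 1))
        * indicator {u. norm u < 1 \<and> 1 - norm u \<le> 1 - norm z} u \<partial>lborel)"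
      by (subst nn_integral_restrict_space)
         (auto simp: nn_integral_completion indicator_def intro!: nn_integral_cong)
    then show ?thesis using C(2)[of z] that by (simp add: space_restrict_space)
  qed
  then show ?thesis using C(1) by blast
qed

text \<open>The abstract bound with \<open>\<delta> z = 1 - norm z\<close>, quasi-triangle constant
  4 and exponent \<open>CARD('n) + 1\<close>.\<close>

lemma positive_bergman_weak_type:
  obtains C :: real where "0 < C"
    "\<And>(f :: complex ^ 'n \<Rightarrow> ennreal) l. f \<in> borel_measurable ball_measure \<Longrightarrow>
       l * emeasure ball_measure {z \<in> space ball_measure. l < (\<integral>\<^sup>+ w.
          ennreal (1 / cmod (1 - hermitian z w) ^ (CARD('n) + 1)) * f w \<partial>ball_measure)}
       \<le> ennreal C * (\<integral>\<^sup>+ w. f w \<partial>ball_measure)"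
proof -
  obtain C where C: "C > 0" "\<And>z::complex ^ 'n. z \<in> space ball_measure \<Longrightarrow>
    (\<integral>\<^sup>+ u. ennreal (1 / cmod (1 - hermitian z u) ^ (CARD('n) + 1))
        * indicator {u. 1 - norm u \<le> 1 - norm z} u \<partial>ball_measure) \<le> ennreal C"
    using nn_integral_half_koranyi_kernel_le by blast
  have norm_meas: "(\<lambda>u. 1 - norm u) \<in> borel_measurable (ball_measure :: (complex ^ 'n) measure)"
    by (intro measurable_restrict_space1 measurable_completion) simp
  have d_meas: "(\<lambda>(z, w). cmod (1 - hermitian z w)) \<in> borel_measurable
     (ball_measure \<Otimes>\<^sub>M (ball_measure :: (complex ^ 'n) measure))"
    using borel_measurable_hermitian_kernel unfolding case_prod_beta' by measurable
  show ?thesis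
  proof (rule that)
    show "0 < 6 * C * (3 * 4) ^ (CARD('n) + 1)" using C by simp
    fix f :: "complex ^ 'n \<Rightarrow> ennreal" and l
    assume f: "f \<in> borel_measurable ball_measure"
    show "l * emeasure ball_measure {z \<in> space ball_measure. l < (\<integral>\<^sup>+ w.
          ennreal (1 / cmod (1 - hermitian z w) ^ (CARD('n) + 1)) * f w \<partial>ball_measure)}
       \<le> ennreal (6 * C * (3 * 4) ^ (CARD('n) + 1)) * (\<integral>\<^sup>+ w. f w \<partial>ball_measure)"
    proof (rule weak_type_quasimetric_kernel[OF finite_ball_measure d_meas norm_meas f _ _ _ C])
      fix x y z :: "complex ^ 'n"
      assume "x \<in> space ball_measure" "y \<in> space ball_measure" "z \<in> space ball_measure"
      then show "cmod (1 - hermitian x y) \<le> 4 * (cmod (1 - hermitian x z) + cmod (1 - hermitian z y))"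
        by (intro koranyi_triangle) (auto simp: space_restrict_space)
    qed (auto simp: space_restrict_space koranyi_sym intro!: koranyi_pos simp del: zero_less_norm_iff)
  qed
qed

text \<open>Both terms of the commutator are at most \<open>B1 * \<kappa>\<close> times the positive
  operator applied to \<open>cmod (f w)\<close>, so its superlevel set at \<open>l\<close> lies in
  that of the positive operator at \<open>l / (2 * B1 * \<kappa>)\<close>.\<close>

lemma weak_type_commutator_bounded:
  fixes g :: "complex ^ 'n \<Rightarrow> complex"
  assumes g_meas: "g \<in> borel_measurable ball_measure" and bound: "\<And>z. z \<in> unit_ball \<Longrightarrow> cmod (g z) \<le> B"
  shows "weak_type_1_1 (commutator g bergman_proj)"
proof -
  define \<kappa> where "\<kappa> = fact CARD('n) / pi ^ CARD('n)"
  have \<kappa>: "0 < \<kappa>" by (simp add: \<kappa>_def)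
  \<comment> \<open>Ensures a positive bound, since it is divided by below.\<close>
  define B1 where "B1 = max B 1"
  have B1: "0 < B1" "\<And>z. z \<in> unit_ball \<Longrightarrow> cmod (g z) \<le> B1"
    using bound unfolding B1_def by (auto simp: le_max_iff_disj)
  obtain C where C: "0 < C"
    "\<And>(f :: complex ^ 'n \<Rightarrow> ennreal) l. f \<in> borel_measurable ball_measure \<Longrightarrow>
       l * emeasure ball_measure {z \<in> space ball_measure. l < (\<integral>\<^sup>+ w.
          ennreal (1 / cmod (1 - hermitian z w) ^ (CARD('n) + 1)) * f w \<partial>ball_measure)}
       \<le> ennreal C * (\<integral>\<^sup>+ w. f w \<partial>ball_measure)"
    using positive_bergman_weak_type by blast
  interpret finite_measure "ball_measure :: (complex ^ 'n) measure" by (rule finite_ball_measure)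
  note [measurable] = borel_measurable_hermitian_kernel[unfolded case_prod_beta']
  show ?thesis unfolding weak_type_1_1_def
  proof (intro exI[of _ "2 * B1 * \<kappa> * C"] conjI allI impI)
    show "0 < 2 * B1 * \<kappa> * C" using B1 \<kappa> C by simp
    fix l :: real and f :: "complex ^ 'n \<Rightarrow> complex"
    assume l: "0 < l" and f: "bounded_compactly_supported f"
    have f_meas [measurable]: "f \<in> borel_measurable ball_measure"
      using f by (simp add: bounded_compactly_supported_def)
    obtain F where F: "\<forall>z\<in>unit_ball. cmod (f z) \<le> F"
      using f unfolding bounded_compactly_supported_def bounded_iff ball_simps by blast
    have f_int: "integrable ball_measure (\<lambda>z. cmod (f z))"
      by (rule integrable_const_bound[of _ F]) (auto simp: space_restrict_space F)
    let ?P = "\<lambda>z. \<integral>\<^sup>+ w. ennreal (1 / cmod (1 - hermitian z w) ^ (CARD('n) + 1)) * ennreal (cmod (f w)) \<partial>ball_measure"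
    define G where "G = {z \<in> space ball_measure. ennreal (l / (2 * B1 * \<kappa>)) < ?P z}"
    have P_meas [measurable]: "?P \<in> borel_measurable ball_measure"
      by (rule borel_measurable_nn_integral) (unfold case_prod_beta', measurable)
    have G_meas: "G \<in> sets ball_measure" unfolding G_def by measurable
    \<comment> \<open>Used with \<open>h = f\<close>, \<open>c = 1\<close> and with \<open>h\<close>
      the product of \<open>g\<close> and \<open>f\<close>, \<open>c = B1\<close>.\<close>
    have proj: "ennreal (cmod (bergman_proj h z)) \<le> ennreal (\<kappa> * c) * ?P z"
      if c: "0 \<le> c" and h: "\<And>w. w \<in> unit_ball \<Longrightarrow> cmod (h w) \<le> c * cmod (f w)" and z: "z \<in> unit_ball"
      for h z c
    proof -
      have "ennreal (cmod (bergman_proj h z)) \<le> (\<integral>\<^sup>+ w. ennreal (cmod (h w * bergman_kernel z w)) \<partial>ball_measure)"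
        unfolding bergman_proj_eq by (rule norm_integral_le_nn_integral)
      also have "\<dots> \<le> (\<integral>\<^sup>+ w. ennreal (\<kappa> * c) * (ennreal (1 / cmod (1 - hermitian z w) ^ (CARD('n) + 1)) * ennreal (cmod (f w))) \<partial>ball_measure)"
      proof (rule nn_integral_mono)
        fix w :: "complex ^ 'n" assume "w \<in> space ball_measure"
        then have w: "w \<in> unit_ball" by (simp add: space_restrict_space)
        have "cmod (h w * bergman_kernel z w) = cmod (h w) * (\<kappa> / cmod (1 - hermitian z w) ^ (CARD('n) + 1))"
          by (simp only: norm_mult norm_divide norm_power bergman_kernel_def \<kappa>_def[symmetric] norm_of_real abs_of_pos[OF \<kappa>])
        also have "\<dots> \<le> (c * cmod (f w)) * (\<kappa> / cmod (1 - hermitian z w) ^ (CARD('n) + 1))"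
          using \<kappa> by (intro mult_right_mono h w) simp
        also have "\<dots> = \<kappa> * c * (1 / cmod (1 - hermitian z w) ^ (CARD('n) + 1) * cmod (f w))"
          by simp
        finally have "ennreal (cmod (h w * bergman_kernel z w))
          \<le> ennreal (\<kappa> * c * (1 / cmod (1 - hermitian z w) ^ (CARD('n) + 1) * cmod (f w)))"
          by (rule ennreal_leI)
        also have "\<dots> = ennreal (\<kappa> * c) * (ennreal (1 / cmod (1 - hermitian z w) ^ (CARD('n) + 1)) * ennreal (cmod (f w)))"
          using \<kappa> c by (subst ennreal_mult, simp, simp, subst ennreal_mult) simp_all
        finally show "ennreal (cmod (h w * bergman_kernel z w)) \<le> \<dots>" .
      qed
      also have "\<dots> = ennreal (\<kappa> * c) * ?P z"
      proof (rule nn_integral_cmult)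
        have "(\<lambda>w. 1 - hermitian z w) \<in> borel_measurable ball_measure"
          using measurable_Pair2[OF borel_measurable_hermitian_kernel, of z] z
          by (simp add: space_restrict_space)
        then show "(\<lambda>w. ennreal (1 / cmod (1 - hermitian z w) ^ (CARD('n) + 1)) * ennreal (cmod (f w)))
            \<in> borel_measurable ball_measure" by measurable
      qed
      finally show ?thesis .
    qed
    have sub: "{z \<in> unit_ball. l < cmod (commutator g bergman_proj f z)} \<subseteq> G"
    proof
      fix z :: "complex ^ 'n" assume "z \<in> {z \<in> unit_ball. l < cmod (commutator g bergman_proj f z)}"
      then have z: "z \<in> unit_ball" and lz: "l < cmod (commutator g bergman_proj f z)" by auto
      have "cmod (commutator g bergman_proj f z)
         \<le> B1 * cmod (bergman_proj f z) + cmod (bergman_proj (\<lambda>w. g w * f w) z)"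
        unfolding commutator_def using B1(2)[OF z]
        by (intro norm_triangle_le_diff add_mono) (simp_all add: norm_mult mult_right_mono)
      with lz have "ennreal l < ennreal (B1 * cmod (bergman_proj f z) + cmod (bergman_proj (\<lambda>w. g w * f w) z))"
        using l by (intro ennreal_lessI) auto
      also have "\<dots> = ennreal B1 * ennreal (cmod (bergman_proj f z)) + ennreal (cmod (bergman_proj (\<lambda>w. g w * f w) z))"
        using B1(1) by (simp add: ennreal_mult)
      also have "\<dots> \<le> ennreal B1 * (ennreal (\<kappa> * 1) * ?P z) + ennreal (\<kappa> * B1) * ?P z"
        using B1 by (intro add_mono mult_left_mono proj z) (auto simp: norm_mult mult_right_mono)
      also have "\<dots> = ennreal (2 * B1 * \<kappa>) * ?P z"
      proof -
        have "ennreal (2 * B1 * \<kappa>) = ennreal B1 * ennreal \<kappa> + ennreal (\<kappa> * B1)"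
          using B1 \<kappa> by (simp add: ennreal_mult[symmetric] ennreal_plus[symmetric] mult_ac del: ennreal_plus)
        then show ?thesis by (simp add: distrib_right mult.assoc)
      qed
      finally have *: "ennreal l < ennreal (2 * B1 * \<kappa>) * ?P z" .
      \<comment> \<open>The division is done by contradiction, as \<open>?P z\<close> is an extended
        real.\<close>
      have "ennreal (l / (2 * B1 * \<kappa>)) < ?P z"
      proof (rule ccontr)
        assume "\<not> ennreal (l / (2 * B1 * \<kappa>)) < ?P z"
        then have "ennreal (2 * B1 * \<kappa>) * ?P z \<le> ennreal (2 * B1 * \<kappa>) * ennreal (l / (2 * B1 * \<kappa>))"
          by (intro mult_left_mono) auto
        also have "\<dots> = ennreal l" using B1 \<kappa> l by (simp add: ennreal_mult[symmetric])
        finally show False using * by simp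
      qed
      then show "z \<in> G" using z by (simp add: G_def space_restrict_space)
    qed
    have "ennreal (l / (2 * B1 * \<kappa>)) * emeasure ball_measure G
        \<le> ennreal C * (\<integral>\<^sup>+ w. ennreal (cmod (f w)) \<partial>ball_measure)"
      unfolding G_def by (rule C(2)) measurable
    then have "l / (2 * B1 * \<kappa>) * measure ball_measure G \<le> C * (\<integral>w. cmod (f w) \<partial>ball_measure)"
      using C l B1 \<kappa> unfolding emeasure_eq_measure nn_integral_eq_integral[OF f_int AE_I2[OF norm_ge_zero]]
      by (simp add: ennreal_mult[symmetric] integral_nonneg_AE)
    then have mG: "measure ball_measure G \<le> 2 * B1 * \<kappa> * C / l * (\<integral>w. cmod (f w) \<partial>ball_measure)"
      using l B1 \<kappa> by (simp add: field_simps)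
    have G_leb: "G \<in> sets lebesgue" "G \<subseteq> unit_ball"
      using G_meas by (auto simp: sets_restrict_space_iff G_def space_restrict_space)
    \<comment> \<open>A non-measurable set has \<open>measure\<close> 0 by convention, so the bound
      holds in either case.\<close>
    have "measure lebesgue {z \<in> unit_ball. l < cmod (commutator g bergman_proj f z)} \<le> measure lebesgue G"
    proof (cases "{z \<in> unit_ball. l < cmod (commutator g bergman_proj f z)} \<in> sets lebesgue")
      case True
      have "G \<in> lmeasurable"
        using G_leb bounded_subset[OF bounded_ball] by (intro bounded_set_imp_lmeasurable) auto
      then show ?thesis by (intro measure_mono_fmeasurable sub True)
    next
      case False
      then show ?thesis by (simp add: measure_notin_sets)
    qed
    also have "measure lebesgue G = measure ball_measure G"
      using G_leb by (simp add: measure_restrict_space)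
    also note mG
    also have "(\<integral>w. cmod (f w) \<partial>ball_measure) = (LINT z:unit_ball|lebesgue. cmod (f z))"
      unfolding set_lebesgue_integral_def by (simp add: integral_restrict_space)
    finally show "measure lebesgue {z \<in> unit_ball. l < cmod (commutator g bergman_proj f z)}
      \<le> 2 * B1 * \<kappa> * C / l * (LINT z:unit_ball|lebesgue. cmod (f z))" .
  qed
qed

subsection \<open>Necessity of boundedness\<close>

text \<open>On the indicator of a small ball at \<open>w\<close> of measure \<open>\<mu>\<close>,
  the commutator is close to \<open>\<mu> * (g z - g w) * bergman_kernel z w\<close>. If
  \<open>g w\<close> were too large, this would exceed a fixed multiple of \<open>\<mu>\<close> on
  more than half of the ball, against the weak-type bound.\<close>

lemma bounded_of_weak_type_commutator:
  fixes g :: "complex ^ 'n \<Rightarrow> complex"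
  assumes cont: "continuous_on unit_ball g"
    and weak: "weak_type_1_1 (commutator g bergman_proj)"
  shows "bounded (g ` unit_ball)"
proof -
  let ?M = "ball_measure :: (complex ^ 'n) measure"
  interpret finite_measure ?M by (rule finite_ball_measure)
  define \<kappa> where "\<kappa> = fact CARD('n) / pi ^ CARD('n)"
  have \<kappa>: "0 < \<kappa>" by (simp add: \<kappa>_def)
  have space: "space ?M = unit_ball" by (simp add: space_restrict_space)
  have g_meas [measurable]: "g \<in> borel_measurable ?M"
    by (rule continuous_imp_measurable_on_sets_lebesgue[OF cont]) simp
  define V where "V = measure ?M (space ?M)"
  have V: "0 < V"
    by (simp add: V_def space measure_restrict_space)
  \<comment> \<open>These sets exhaust the ball, so one of them fills more than half of it;
    \<open>m\<close> is fixed before \<open>w\<close> is chosen.\<close>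
  define A where "A m = {z \<in> space ?M. cmod (g z) \<le> real m}" for m
  have A_meas: "A m \<in> sets ?M" for m unfolding A_def by measurable
  have "(\<lambda>m. measure ?M (A m)) \<longlonglongrightarrow> measure ?M (\<Union>m. A m)"
    using A_meas by (intro finite_Lim_measure_incseq) (auto simp: incseq_def A_def)
  moreover have "(\<Union>m. A m) = space ?M"
    using real_arch_simple by (auto simp: A_def)
  ultimately have "eventually (\<lambda>m. V / 2 < measure ?M (A m)) sequentially"
    using V by (intro order_tendstoD(1)) (auto simp: V_def)
  then obtain m where m: "V / 2 < measure ?M (A m)"
    by (auto simp: eventually_sequentially)
  obtain C where C: "0 < C" "\<And>l f. 0 < l \<Longrightarrow> bounded_compactly_supported f \<Longrightarrow>
      measure lebesgue {z \<in> unit_ball. l < cmod (commutator g bergman_proj f z)}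
        \<le> C / l * (LINT z:unit_ball|lebesgue. cmod (f z))"
    using weak unfolding weak_type_1_1_def by blast
  \<comment> \<open>Chosen so that the weak-type bound at level \<open>\<eta> * \<mu>\<close> for a
    function of mass \<open>\<mu>\<close> is exactly \<open>V / 2\<close>.\<close>
  define \<eta> where "\<eta> = 2 * C / V"
  have \<eta>: "0 < \<eta>" using C V by (simp add: \<eta>_def)
  \<comment> \<open>Chosen so that \<open>s\<close> times the lower bound
    \<open>\<kappa> / 2 ^ (CARD('n) + 1)\<close> of the kernel is \<open>2 * \<eta>\<close>: one
    \<open>\<eta>\<close> is lost to the approximation at \<open>w\<close>, one remains for the
    level.\<close>
  define s where "s = 2 * \<eta> * 2 ^ (CARD('n) + 1) / \<kappa>"
  have s: "0 < s" using \<eta> \<kappa> by (simp add: s_def)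
  have "cmod (g w) \<le> real m + s" if w: "w \<in> unit_ball" for w
  proof (rule ccontr)
    assume large: "\<not> cmod (g w) \<le> real m + s"
    obtain r0 where r0: "0 < r0" "cball w r0 \<subseteq> unit_ball"
      using open_contains_cball[THEN iffD1, OF open_ball, THEN bspec, OF w] by blast
    \<comment> \<open>The value \<open>g z\<close> becomes a free parameter \<open>\<beta>\<close>
      in a closed disc, because \<open>g\<close> need not extend continuously to the sphere. On the
      compact domain \<open>?S\<close> uniform continuity gives one radius for all \<open>z\<close>
      in \<open>A m\<close>.\<close>
    define \<Psi> where "\<Psi> = (\<lambda>(\<beta>, z, u). (\<beta> - g u) * bergman_kernel z u)"
    let ?S = "cball 0 (real m) \<times> cball 0 1 \<times> cball w r0"
    have nz: "1 - hermitian z u \<noteq> 0" if "norm z \<le> 1" "u \<in> cball w r0" for z u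
      using koranyi_pos[of u z] that r0(2) koranyi_sym[of z u] by (auto simp: subset_iff)
    have cont_g: "continuous_on (cball w r0) g"
      using cont r0(2) by (rule continuous_on_subset)
    have kernel_cont: "continuous_on (cball w r0) (bergman_kernel z)" if "z \<in> unit_ball" for z
      unfolding bergman_kernel_def[abs_def] using nz[of z] that
      by (intro continuous_intros) auto
    have "continuous_on ?S \<Psi>"
      unfolding \<Psi>_def bergman_kernel_def case_prod_beta'
      using nz by (intro continuous_intros continuous_on_compose2[OF cont_g]) auto
    then have "uniformly_continuous_on ?S \<Psi>"
      by (intro compact_uniformly_continuous compact_Times compact_cball)
    then obtain \<delta> where \<delta>: "0 < \<delta>" "\<And>x y. x \<in> ?S \<Longrightarrow> y \<in> ?S \<Longrightarrow> dist x y < \<delta> \<Longrightarrow> dist (\<Psi> x) (\<Psi> y) < \<eta>"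
      using \<eta> unfolding uniformly_continuous_on_def by metis
    define r where "r = min \<delta> r0"
    have r: "0 < r" "r \<le> \<delta>" "r \<le> r0" using \<delta> r0 by (auto simp: r_def)
    define f where "f = (\<lambda>u. indicator (ball w r) u :: complex)"
    define \<mu> where "\<mu> = measure lebesgue (ball w r)"
    have \<mu>: "0 < \<mu>" using r by (simp add: \<mu>_def)
    have ball_sub: "ball w r \<subseteq> unit_ball" "ball w r \<subseteq> cball w r0" using r r0 by auto
    have ball_sets: "ball w r \<in> sets ?M"
      using ball_sub by (simp add: sets_restrict_space_iff)
    have f_meas [measurable]: "f \<in> borel_measurable ?M"
      unfolding f_def by (rule borel_measurable_indicator[OF ball_sets])
    have \<mu>_eq: "measure ?M (ball w r) = \<mu>"
      using ball_sub by (simp add: \<mu>_def measure_restrict_space)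
    have bcs: "bounded_compactly_supported f"
      unfolding bounded_compactly_supported_def
    proof (intro conjI exI[of _ "cball w r0"] f_meas)
      show "bounded (f ` unit_ball)"
        by (rule boundedI[of _ 1]) (auto simp: f_def indicator_def)
      show "\<forall>z\<in>unit_ball - cball w r0. f z = 0"
        using ball_sub by (auto simp: f_def indicator_def)
    qed (use r0 in auto)
    \<comment> \<open>\<open>f\<close> vanishes off the small ball, and \<open>\<phi>\<close> is
      bounded on the compact ball containing it.\<close>
    have f_int: "integrable ?M (\<lambda>u. f u * \<phi> u)"
      if cont: "continuous_on (cball w r0) \<phi>" and [measurable]: "\<phi> \<in> borel_measurable ?M" for \<phi>
    proof -
      obtain B where B: "\<And>u. u \<in> cball w r0 \<Longrightarrow> cmod (\<phi> u) \<le> B"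
        using compact_imp_bounded[OF compact_continuous_image[OF cont compact_cball]]
        unfolding bounded_iff ball_simps by blast
      have "0 \<le> B" using order_trans[OF norm_ge_zero B[of w]] r0 by simp
      show ?thesis
      proof (rule integrable_const_bound[of _ B])
        show "AE u in ?M. cmod (f u * \<phi> u) \<le> B"
          using B ball_sub \<open>0 \<le> B\<close> by (auto simp: f_def indicator_def subset_iff)
      qed measurable
    qed
    have lower: "\<eta> * \<mu> < cmod (commutator g bergman_proj f z)" if z: "z \<in> A m" for z
    proof -
      have zb: "z \<in> unit_ball" "cmod (g z) \<le> real m" using z by (auto simp: A_def space)
      have K_meas [measurable]: "bergman_kernel z \<in> borel_measurable ?M"
        using measurable_Pair2[OF borel_measurable_bergman_kernel, of z] zb by (simp add: space)
      have i1: "integrable ?M (\<lambda>u. f u * bergman_kernel z u)"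
        by (rule f_int[OF kernel_cont[OF zb(1)]]) measurable
      have i2: "integrable ?M (\<lambda>u. f u * (g u * bergman_kernel z u))"
        by (rule f_int[OF continuous_on_mult[OF cont_g kernel_cont[OF zb(1)]]]) measurable
      let ?\<psi> = "\<lambda>u. \<Psi> (g z, z, u)"
      have i\<psi>: "integrable ?M (\<lambda>u. f u * ?\<psi> u)"
        using Bochner_Integration.integrable_diff[OF integrable_mult_right[OF i1, of "g z"] i2]
        by (simp add: \<Psi>_def algebra_simps)
      have ic: "integrable ?M (\<lambda>u. f u * c)" for c by (rule f_int) auto
      have comm: "commutator g bergman_proj f z = (\<integral>u. f u * ?\<psi> u \<partial>?M)"
      proof -
        have "commutator g bergman_proj f z = (\<integral>u. g z * (f u * bergman_kernel z u) \<partial>?M)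
            - (\<integral>u. f u * (g u * bergman_kernel z u) \<partial>?M)"
          unfolding commutator_def bergman_proj_eq integral_mult_right_zero
          by (simp only: mult.assoc mult.left_commute[of "g _" "f _"])
        also have "\<dots> = (\<integral>u. g z * (f u * bergman_kernel z u) - f u * (g u * bergman_kernel z u) \<partial>?M)"
          by (rule Bochner_Integration.integral_diff[symmetric, OF integrable_mult_right[OF i1] i2])
        finally show ?thesis by (simp add: \<Psi>_def algebra_simps)
      qed
      have f1: "(\<integral>u. f u * c \<partial>?M) = of_real \<mu> * c" for c
      proof -
        have "(\<integral>u. f u * c \<partial>?M) = (\<integral>u. indicator (ball w r) u *\<^sub>R c \<partial>?M)"
          by (intro Bochner_Integration.integral_cong) (auto simp: f_def indicator_def)
        also have "\<dots> = \<mu> *\<^sub>R c"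
          using \<mu>_eq ball_sets by (simp add: emeasure_eq_measure Int_absorb2[OF ball_sub(1)])
        finally show ?thesis by (simp add: scaleR_conv_of_real)
      qed
      \<comment> \<open>Freezing the integration variable at the centre \<open>w\<close> costs at
        most \<open>\<eta>\<close> pointwise on the small ball, hence \<open>\<mu> * \<eta>\<close>
        in total.\<close>
      have "cmod ((\<integral>u. f u * ?\<psi> u \<partial>?M) - (\<integral>u. f u * ?\<psi> w \<partial>?M))
          = cmod (\<integral>u. f u * ?\<psi> u - f u * ?\<psi> w \<partial>?M)"
        by (simp only: Bochner_Integration.integral_diff[OF i\<psi> ic])
      also have "\<dots> \<le> (\<integral>u. cmod (f u * ?\<psi> u - f u * ?\<psi> w) \<partial>?M)"
        by (rule integral_norm_bound)
      also have "\<dots> \<le> (\<integral>u. indicator (ball w r) u *\<^sub>R \<eta> \<partial>?M)"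
      proof (rule integral_mono)
        fix u assume "u \<in> space ?M"
        show "cmod (f u * ?\<psi> u - f u * ?\<psi> w) \<le> indicator (ball w r) u *\<^sub>R \<eta>"
        proof (cases "u \<in> ball w r")
          case True
          have "dist (\<Psi> (g z, z, u)) (\<Psi> (g z, z, w)) < \<eta>"
          proof (rule \<delta>(2))
            show "(g z, z, u) \<in> ?S" "(g z, z, w) \<in> ?S"
              using zb True ball_sub r0 by (auto simp: less_imp_le)
            show "dist (g z, z, u) (g z, z, w) < \<delta>"
              using True r by (simp add: dist_Pair_Pair dist_commute)
          qed
          then show ?thesis using True by (simp add: f_def dist_norm)
        qed (simp add: f_def)
      qed (use ball_sets i\<psi> ic in \<open>auto intro!: integrable_norm Bochner_Integration.integrable_diff
             simp: emeasure_eq_measure integrable_indicator_iff\<close>)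
      also have "\<dots> = \<mu> * \<eta>"
        using \<mu>_eq ball_sets by (simp add: emeasure_eq_measure Int_absorb2[OF ball_sub(1)])
      finally have close: "cmod ((\<integral>u. f u * ?\<psi> u \<partial>?M) - of_real \<mu> * ?\<psi> w) \<le> \<mu> * \<eta>"
        by (simp only: f1)
      have "s < cmod (g z - g w)"
        using norm_triangle_ineq2[of "g w" "g z"] zb large by (simp add: norm_minus_commute)
      moreover have "\<kappa> / 2 ^ (CARD('n) + 1) \<le> cmod (bergman_kernel z w)"
      proof -
        have "cmod (hermitian z w) \<le> 1"
          using norm_hermitian_le[of z w] zb w mult_mono[of "norm z" 1 "norm w" 1] by auto
        then have "cmod (1 - hermitian z w) \<le> 2"
          using norm_triangle_ineq4[of 1 "hermitian z w"] by simp
        then have "cmod (1 - hermitian z w) ^ (CARD('n) + 1) \<le> 2 ^ (CARD('n) + 1)"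
          by (intro power_mono) auto
        moreover have "0 < cmod (1 - hermitian z w)" using zb w by (intro koranyi_pos) auto
        ultimately have "\<kappa> / 2 ^ (CARD('n) + 1) \<le> \<kappa> / cmod (1 - hermitian z w) ^ (CARD('n) + 1)"
          using \<kappa> by (intro divide_left_mono mult_pos_pos zero_less_power) auto
        also have "\<dots> = cmod (bergman_kernel z w)"
          by (simp only: norm_divide norm_power bergman_kernel_def \<kappa>_def[symmetric] norm_of_real abs_of_pos[OF \<kappa>])
        finally show ?thesis .
      qed
      ultimately have "s * (\<kappa> / 2 ^ (CARD('n) + 1)) < cmod (g z - g w) * cmod (bergman_kernel z w)"
        using s \<kappa> by (intro mult_less_le_imp_less) auto
      then have "2 * \<eta> < cmod (?\<psi> w)"
        using \<kappa> by (simp add: \<Psi>_def norm_mult s_def)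
      then have "\<mu> * (2 * \<eta>) < cmod (of_real \<mu> * ?\<psi> w)"
        using \<mu> by (simp add: norm_mult)
      also have "\<dots> \<le> cmod (\<integral>u. f u * ?\<psi> u \<partial>?M) + \<mu> * \<eta>"
        using close norm_triangle_sub[of "of_real \<mu> * ?\<psi> w" "\<integral>u. f u * ?\<psi> u \<partial>?M"]
        by (simp add: norm_minus_commute)
      finally show ?thesis unfolding comm by (simp add: algebra_simps)
    qed
    let ?Q = "{z \<in> unit_ball. \<eta> * \<mu> < cmod (commutator g bergman_proj f z)}"
    \<comment> \<open>Monotonicity of the measure from \<open>A m\<close> to \<open>?Q\<close>
      requires \<open>?Q\<close> to be measurable.\<close>
    have "commutator g bergman_proj f \<in> borel_measurable ?M"
    proof -
      have [measurable]: "bergman_proj f \<in> borel_measurable ?M"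
        "bergman_proj (\<lambda>w. g w * f w) \<in> borel_measurable ?M"
        by (intro borel_measurable_bergman_proj, measurable)+
      show ?thesis unfolding commutator_def by measurable
    qed
    then have "{z \<in> space ?M. \<eta> * \<mu> < cmod (commutator g bergman_proj f z)} \<in> sets ?M"
      by measurable
    then have Q_meas: "?Q \<in> sets ?M" by (simp add: space)
    have "V / 2 < measure ?M (A m)" by (rule m)
    also have "\<dots> \<le> measure ?M ?Q"
      using lower by (intro finite_measure_mono Q_meas) (auto simp: A_def space)
    also have "\<dots> = measure lebesgue ?Q"
      by (subst measure_restrict_space) auto
    also have "\<dots> \<le> C / (\<eta> * \<mu>) * (LINT z:unit_ball|lebesgue. cmod (f z))"
      using C(2)[OF _ bcs, of "\<eta> * \<mu>"] \<eta> \<mu> by simp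
    also have "(LINT z:unit_ball|lebesgue. cmod (f z)) = (\<integral>z. indicator (ball w r) z \<partial>lebesgue)"
      unfolding set_lebesgue_integral_def using ball_sub
      by (intro Bochner_Integration.integral_cong) (auto simp: f_def indicator_def)
    also have "\<dots> = \<mu>" by (simp add: \<mu>_def)
    \<comment> \<open>The mass \<open>\<mu>\<close> cancels, so the contradiction does not depend on
      the radius of the test ball.\<close>
    also have "C / (\<eta> * \<mu>) * \<mu> = V / 2" using \<mu> C V by (simp add: \<eta>_def)
    finally show False by simp
  qed
  then show ?thesis unfolding bounded_iff by blast
qed

section \<open>Equivalence for holomorphic symbols\<close>

theorem theorem3:
  fixes b :: "complex ^ 'n \<Rightarrow> complex"
  assumes "holomorphic_Cn_on b unit_ball"
  shows "weak_type_1_1 (commutator (\<lambda>z. cnj (b z)) bergman_proj) \<longleftrightarrow> b \<in> H_infinity"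
proof -
  have "continuous_on unit_ball b"
    using assms unfolding holomorphic_Cn_on_def
    by (meson continuous_at_imp_continuous_on has_derivative_continuous)
  \<comment> \<open>Both directions concern the symbol \<open>cnj (b z)\<close>, which inherits
    continuity from \<open>b\<close> and has the same modulus.\<close>
  then have cont: "continuous_on unit_ball (\<lambda>z. cnj (b z))" by (intro continuous_intros)
  have bounded_cnj: "bounded ((\<lambda>z. cnj (b z)) ` unit_ball) \<longleftrightarrow> bounded (b ` unit_ball)"
    by (simp add: bounded_iff)
  show ?thesis
  proof
    assume "weak_type_1_1 (commutator (\<lambda>z. cnj (b z)) bergman_proj)"
    from bounded_of_weak_type_commutator[OF cont this] show "b \<in> H_infinity"
      using assms unfolding H_infinity_def bounded_cnj by simp
  next
    assume "b \<in> H_infinity"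
    then obtain B where "\<forall>z\<in>unit_ball. cmod (cnj (b z)) \<le> B"
      unfolding H_infinity_def bounded_iff by auto
    moreover have "(\<lambda>z. cnj (b z)) \<in> borel_measurable ball_measure"
      by (rule continuous_imp_measurable_on_sets_lebesgue[OF cont]) simp
    ultimately show "weak_type_1_1 (commutator (\<lambda>z. cnj (b z)) bergman_proj)"
      using weak_type_commutator_bounded by blast
  qed
qed

end
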